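(* Let $(\Omega,\mathcal{B},m)$ be a measure space with $m$ $\sigma$-finite. The Hölder score is a composite score. That is: (1) for every $\gamma>0$ and every function $\phi:\mathbb{R}_+\to\mathbb{R}$ with $\phi(1)=-1$ and $\phi(z)\ge -z^{1+\gamma}$ for all $z\ge 0$, the function $$S(f,g)=\phi\!\left(\frac{\langle f g^\gamma\rangle}{\langle g^{1+\gamma}\rangle}\right)\langle g^{1+\gamma}\rangle,\qquad f,g\in\mathcal{F}=L_{1+\gamma}^+,$$ is a composite score on $\mathcal{F}$; and (2) (the case $\gamma=0$) for every convex set $\mathcal{F}\subset L_1^+$ such that $f\log g$ is integrable for all $f,g\in\mathcal{F}$, the function $S(f,g)=\langle -f\log g+g\rangle$, $f,g\in\mathcal{F}$, is a composite score on $\mathcal{F}$.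
   Context: Notation: $\mathbb{R}_+=[0,\infty)$; $\langle f\rangle=\int_\Omega f\,dm$. $L_0$ is the set of measurable functions $f:\Omega\to\mathbb{R}$; for $\alpha\ge1$, $L_\alpha=\{f\in L_0: \langle|f|^\alpha\rangle<\infty\}$; for $\alpha=0$ or $\alpha\ge 1$, $L_\alpha^+=\{f\in L_\alpha: f\ge 0,\ f\ne 0\}$ (non-zero meaning not almost everywhere zero). In $f\log g$ the conventions $\log 0=-\infty$ and $0\cdot\infty=0$ are used. Composite score: let $\mathcal{F}$ be a convex subset of $L_0^+$ and $\mathcal{P}=\{p\in\mathcal{F}:\langle p\rangle=1\}$. A function $S:\mathcal{F}\times\mathcal{F}\to\mathbb{R}$ is a composite score on $\mathcal{F}$ if: (i) $S(f,g)=T\big(\int_\Omega S_0(\omega,g)f(\omega)\,dm(\omega),\,g\big)$ for some $S_0:\Omega\times\mathcal{F}\to\mathbb{R}$ and $T:\mathbb{R}\times\mathcal{F}\to\mathbb{R}$, where $S_0(\cdot,g)f(\cdot)$ is integrable for all $f,g\in\mathcal{F}$; (ii) $S(f,g)\ge S(f,f)$ for all $f,g\in\mathcal{F}$; (iii) for $p,q\in\mathcal{P}$, $S(p,q)=S(p,p)$ implies $p=q$ almost everywhere. *)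

theory Defs
  imports "HOL-Analysis.Analysis"
begin

text \<open>
  The base set is \<open>space M\<close>. As usual in HOL, functions on it are total functions on the
  underlying type, and their values outside \<open>space M\<close> are irrelevant. Functions are not
  identified almost everywhere.
\<close>

definition L :: "'a measure \<Rightarrow> real \<Rightarrow> ('a \<Rightarrow> real) set" where
  "L M \<alpha> = {f \<in> borel_measurable M. (\<integral>\<^sup>+ \<omega>. ennreal (\<bar>f \<omega>\<bar> powr \<alpha>) \<partial>M) < \<infinity>}"

definition nonneg_nonzero :: "'a measure \<Rightarrow> ('a \<Rightarrow> real) \<Rightarrow> bool" where
  "nonneg_nonzero M f \<longleftrightarrow> (\<forall>\<omega>\<in>space M. 0 \<le> f \<omega>) \<and> \<not> (AE \<omega> in M. f \<omega> = 0)"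

text \<open>
  \<open>L\<^sub>0\<close> consists of all measurable functions. It is not the case \<open>\<alpha> = 0\<close> of
  \<^term>\<open>L\<close>, which would impose finite measure of the support.
\<close>

definition L0_plus :: "'a measure \<Rightarrow> ('a \<Rightarrow> real) set" where
  "L0_plus M = {f \<in> borel_measurable M. nonneg_nonzero M f}"

definition L_plus :: "'a measure \<Rightarrow> real \<Rightarrow> ('a \<Rightarrow> real) set" where
  "L_plus M \<alpha> = {f \<in> L M \<alpha>. nonneg_nonzero M f}"

text \<open>The library constant \<^const>\<open>convex\<close> needs a real vector space type, and there is no such
  instance for function types.\<close>

definition convex_funs :: "('a \<Rightarrow> real) set \<Rightarrow> bool" where
  "convex_funs F \<longleftrightarrow>
    (\<forall>f\<in>F. \<forall>g\<in>F. \<forall>t\<in>{0..1}. (\<lambda>\<omega>. (1 - t) * f \<omega> + t * g \<omega>) \<in> F)"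

text \<open>
  The condition \<open>\<langle>p\<rangle> = 1\<close> includes integrability of \<open>p\<close>: the Bochner integral of a
  non-integrable function is \<open>0\<close>.
\<close>

definition densities :: "'a measure \<Rightarrow> ('a \<Rightarrow> real) set \<Rightarrow> ('a \<Rightarrow> real) set" where
  "densities M F = {p \<in> F. (\<integral>\<omega>. p \<omega> \<partial>M) = 1}"

definition composite_score ::
  "'a measure \<Rightarrow> ('a \<Rightarrow> real) set \<Rightarrow> (('a \<Rightarrow> real) \<Rightarrow> ('a \<Rightarrow> real) \<Rightarrow> real) \<Rightarrow> bool" where
  "composite_score M F S \<longleftrightarrow>
    F \<subseteq> L0_plus M \<and> convex_funs F \<and>
    (\<exists>(S0 :: 'a \<Rightarrow> ('a \<Rightarrow> real) \<Rightarrow> real) (T :: real \<Rightarrow> ('a \<Rightarrow> real) \<Rightarrow> real).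
      \<forall>f\<in>F. \<forall>g\<in>F. integrable M (\<lambda>\<omega>. S0 \<omega> g * f \<omega>) \<and>
        S f g = T (\<integral>\<omega>. S0 \<omega> g * f \<omega> \<partial>M) g) \<and>
    (\<forall>f\<in>F. \<forall>g\<in>F. S f g \<ge> S f f) \<and>
    (\<forall>p\<in>densities M F. \<forall>q\<in>densities M F. S p q = S p p \<longrightarrow> (AE \<omega> in M. p \<omega> = q \<omega>))"

text \<open>
  The library's Bochner integral takes values in a Banach space. Integrands that may be infinite
  (on a null set, if they are integrable) are integrated as the difference of the integrals of the
  positive and negative parts; \<^const>\<open>e2ennreal\<close> maps negative numbers to \<open>0\<close>.
\<close>

definition ext_integrable :: "'a measure \<Rightarrow> ('a \<Rightarrow> ereal) \<Rightarrow> bool" where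
  "ext_integrable M h \<longleftrightarrow>
    h \<in> borel_measurable M \<and> (\<integral>\<^sup>+ \<omega>. e2ennreal \<bar>h \<omega>\<bar> \<partial>M) < \<infinity>"

definition ext_integral :: "'a measure \<Rightarrow> ('a \<Rightarrow> ereal) \<Rightarrow> real" where
  "ext_integral M h =
    enn2real (\<integral>\<^sup>+ \<omega>. e2ennreal (h \<omega>) \<partial>M) - enn2real (\<integral>\<^sup>+ \<omega>. e2ennreal (- h \<omega>) \<partial>M)"

definition ext_log :: "real \<Rightarrow> ereal" where
  "ext_log x = (if x = 0 then - \<infinity> else ereal (ln x))"

text \<open>The product of \<^typ>\<open>ereal\<close> satisfies \<open>0 * \<infinity> = 0 * (- \<infinity>) = 0\<close>.\<close>

definition times_log :: "('a \<Rightarrow> real) \<Rightarrow> ('a \<Rightarrow> real) \<Rightarrow> 'a \<Rightarrow> ereal" where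
  "times_log f g \<omega> = ereal (f \<omega>) * ext_log (g \<omega>)"

definition holder_score ::
  "'a measure \<Rightarrow> real \<Rightarrow> (real \<Rightarrow> real) \<Rightarrow> ('a \<Rightarrow> real) \<Rightarrow> ('a \<Rightarrow> real) \<Rightarrow> real" where
  "holder_score M \<gamma> \<phi> f g =
    \<phi> ((\<integral>\<omega>. f \<omega> * g \<omega> powr \<gamma> \<partial>M) / (\<integral>\<omega>. g \<omega> powr (1 + \<gamma>) \<partial>M)) *
    (\<integral>\<omega>. g \<omega> powr (1 + \<gamma>) \<partial>M)"

definition holder_score_zero ::
  "'a measure \<Rightarrow> ('a \<Rightarrow> real) \<Rightarrow> ('a \<Rightarrow> real) \<Rightarrow> real" where
  "holder_score_zero M f g = ext_integral M (\<lambda>\<omega>. - times_log f g \<omega> + ereal (g \<omega>))"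

end

theory Submission
  imports Defs
begin

text \<open>
  Both scores are optimal at \<open>g = f\<close> because the difference of scores is bounded below by the
  integral of a pointwise non-negative gap, which vanishes only where
  \<open>f\<close> and \<open>g\<close> agree, up to a constant factor in the case \<open>\<gamma> > 0\<close>.

  For \<open>\<gamma> > 0\<close> put \<open>z = \<langle>f g\<^sup>\<gamma>\<rangle> / \<langle>g\<^sup>1\<^sup>+\<^sup>\<gamma>\<rangle>\<close>. Since \<open>\<phi>\<close> lies above \<open>- z\<^sup>1\<^sup>+\<^sup>\<gamma>\<close> and touches it at \<open>1\<close>, optimality
  reduces to \<open>z\<^sup>1\<^sup>+\<^sup>\<gamma> \<langle>g\<^sup>1\<^sup>+\<^sup>\<gamma>\<rangle> \<le> \<langle>f\<^sup>1\<^sup>+\<^sup>\<gamma>\<rangle>\<close>, a form of Hoelder's inequality. It is obtained by integrating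
  Young's inequality \<open>(1 + \<gamma>) a b\<^sup>\<gamma> \<le> a\<^sup>1\<^sup>+\<^sup>\<gamma> + \<gamma> b\<^sup>1\<^sup>+\<^sup>\<gamma>\<close> at \<open>a = f(\<omega>)\<close> and \<open>b = z g(\<omega>)\<close>: with this scaling
  of \<open>g\<close> the left side integrates to \<open>(1 + \<gamma>) z\<^sup>1\<^sup>+\<^sup>\<gamma> \<langle>g\<^sup>1\<^sup>+\<^sup>\<gamma>\<rangle>\<close>, so that \<open>\<gamma>\<close> of the \<open>1 + \<gamma>\<close> copies cancel
  (lemma \<open>holder_ratio\<close>). Equality of the integrals forces equality in Young's inequality almost
  everywhere, that is \<open>f = z g\<close>; for two densities integration gives \<open>z = 1\<close>.

  For \<open>\<gamma> = 0\<close> the gap is \<open>(g - f log g) - (f - f log f)\<close>, which is non-negative by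
  \<open>log x \<le> x - 1\<close> at \<open>x = g / f\<close> (lemma \<open>gibbs_pointwise\<close>). Integrability of \<open>f log g\<close> makes \<open>f\<close> vanish
  almost everywhere on the zero set of \<open>g\<close>, so all integrands can be replaced by
  real-valued ones.
\<close>

section \<open>Pointwise inequalities\<close>

text \<open>
  For \<open>a, b > 0\<close>, after division by \<open>a b\<^sup>c\<close> the gap is \<open>(u - 1 - log u) + c (v - 1 - log v)\<close> with \<open>u = (a/b)\<^sup>c\<close> and \<open>v = b/a\<close>,
  since the logarithms cancel. Both summands are non-negative, and the second one vanishes only
  for \<open>a = b\<close>.
\<close>

lemma young_powr:
  fixes a b c :: real
  assumes c: "c > 0" and a: "a \<ge> 0" and b: "b \<ge> 0"
  shows "(1 + c) * (a * b powr c) \<le> a powr (1 + c) + c * b powr (1 + c)"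
    and "(1 + c) * (a * b powr c) = a powr (1 + c) + c * b powr (1 + c) \<Longrightarrow> a = b"
proof -
  have *: "(1 + c) * (a * b powr c) \<le> a powr (1 + c) + c * b powr (1 + c) \<and>
    ((1 + c) * (a * b powr c) = a powr (1 + c) + c * b powr (1 + c) \<longrightarrow> a = b)"
  proof (cases "a = 0 \<or> b = 0")
    case True
    then show ?thesis using c a b by (auto simp: add_nonneg_eq_0_iff)
  next
    case False
    then have pos: "a > 0" "b > 0" using a b by auto
    define u where "u = (a / b) powr c"
    define v where "v = b / a"
    have u: "u > 0" and v: "v > 0" using pos by (auto simp: u_def v_def)
    have lnu: "ln u = - c * ln v"
      using pos by (simp add: u_def v_def ln_powr ln_div algebra_simps)
    have m: "a * b powr c > 0" using pos by simp
    have e1: "a powr (1 + c) = a * b powr c * u"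
      using pos by (simp add: u_def powr_divide powr_add)
    have e2: "c * b powr (1 + c) = a * b powr c * (c * v)"
      using pos by (simp add: v_def powr_add)
    have gap: "a powr (1 + c) + c * b powr (1 + c) - (1 + c) * (a * b powr c)
        = a * b powr c * ((u - 1 - ln u) + c * (v - 1 - ln v))"
      unfolding e1 e2 lnu by (simp add: algebra_simps)
    have gu: "u - 1 - ln u \<ge> 0" using ln_le_minus_one[OF u] by simp
    have gv: "c * (v - 1 - ln v) \<ge> 0" using ln_le_minus_one[OF v] c by simp
    have "a = b" if "(1 + c) * (a * b powr c) = a powr (1 + c) + c * b powr (1 + c)"
    proof -
      have "(u - 1 - ln u) + c * (v - 1 - ln v) = 0"
        using gap that m by (simp only: mult_eq_0_iff diff_self) auto
      then have "c * (v - 1 - ln v) = 0"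
        using gu gv by linarith
      then have "v = 1" using c ln_eq_minus_one[OF v] by simp
      then show ?thesis using pos by (simp add: v_def)
    qed
    moreover have "a * b powr c * ((u - 1 - ln u) + c * (v - 1 - ln v)) \<ge> 0"
      by (rule mult_nonneg_nonneg[OF less_imp_le[OF m] add_nonneg_nonneg[OF gu gv]])
    ultimately show ?thesis using gap by linarith
  qed
  show "(1 + c) * (a * b powr c) \<le> a powr (1 + c) + c * b powr (1 + c)"
    using * by blast
  show "(1 + c) * (a * b powr c) = a powr (1 + c) + c * b powr (1 + c) \<Longrightarrow> a = b"
    using * by blast
qed

text \<open>
  The support condition excludes \<open>a > 0 = b\<close>: there the convention \<open>ln 0 = 0\<close> would replace
  the infinite value of \<open>- a log b\<close> and the inequality could fail.
\<close>

lemma gibbs_pointwise: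
  fixes a b :: real
  assumes a: "a \<ge> 0" and b: "b \<ge> 0" and supp: "b = 0 \<longrightarrow> a = 0"
  shows "a - a * ln a \<le> b - a * ln b"
    and "a - a * ln a = b - a * ln b \<Longrightarrow> a = b"
proof -
  have *: "a - a * ln a \<le> b - a * ln b \<and> (a - a * ln a = b - a * ln b \<longrightarrow> a = b)"
  proof (cases "a = 0")
    case True
    then show ?thesis using b by simp
  next
    case False
    then have pos: "a > 0" "b > 0" using a b supp by (auto simp: less_le)
    define v where "v = b / a"
    have v: "v > 0" using pos by (simp add: v_def)
    have gap: "(b - a * ln b) - (a - a * ln a) = a * (v - 1 - ln v)"
      using pos by (simp add: v_def ln_div algebra_simps)
    have "a = b" if "a - a * ln a = b - a * ln b"
    proof -
      have "v - 1 - ln v = 0" using gap that pos by auto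
      then have "v = 1" using ln_eq_minus_one[OF v] by simp
      then show ?thesis using pos by (simp add: v_def)
    qed
    moreover have "a * (v - 1 - ln v) \<ge> 0"
      using ln_le_minus_one[OF v] pos by simp
    ultimately show ?thesis using gap by linarith
  qed
  show "a - a * ln a \<le> b - a * ln b" using * by blast
  show "a - a * ln a = b - a * ln b \<Longrightarrow> a = b" using * by blast
qed

lemma AE_eq_of_AE_le_integral_eq:
  fixes f g :: "'a \<Rightarrow> real"
  assumes "integrable M f" "integrable M g" "AE x in M. f x \<le> g x"
    and "(\<integral>x. f x \<partial>M) = (\<integral>x. g x \<partial>M)"
  shows "AE x in M. f x = g x"
proof -
  have "(\<integral>x. g x - f x \<partial>M) = 0" using assms by simp
  then have "AE x in M. g x - f x = 0"
    using assms by (subst integral_nonneg_eq_0_iff_AE[symmetric]) auto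
  then show ?thesis by eventually_elim simp
qed

section \<open>Non-negative functions with integrable powers\<close>

lemma L_plusD:
  assumes "f \<in> L_plus M \<alpha>"
  shows L_plus_measurable: "f \<in> borel_measurable M"
    and L_plus_nonneg: "\<And>\<omega>. \<omega> \<in> space M \<Longrightarrow> 0 \<le> f \<omega>"
    and L_plus_nonzero: "\<not> (AE \<omega> in M. f \<omega> = 0)"
    and L_plus_integrable_powr: "integrable M (\<lambda>\<omega>. f \<omega> powr \<alpha>)"
proof -
  show f[measurable]: "f \<in> borel_measurable M" and nn: "\<And>\<omega>. \<omega> \<in> space M \<Longrightarrow> 0 \<le> f \<omega>"
    and "\<not> (AE \<omega> in M. f \<omega> = 0)"
    using assms by (auto simp: L_plus_def L_def nonneg_nonzero_def)
  have "(\<integral>\<^sup>+ \<omega>. ennreal (norm (f \<omega> powr \<alpha>)) \<partial>M) = (\<integral>\<^sup>+ \<omega>. ennreal (\<bar>f \<omega>\<bar> powr \<alpha>) \<partial>M)"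
    by (intro nn_integral_cong) (simp add: nn)
  also have "\<dots> < \<infinity>" using assms by (simp add: L_plus_def L_def)
  finally show "integrable M (\<lambda>\<omega>. f \<omega> powr \<alpha>)"
    by (intro integrableI_bounded) measurable
qed

lemma L_plusI:
  assumes [measurable]: "f \<in> borel_measurable M" and nn: "\<And>\<omega>. \<omega> \<in> space M \<Longrightarrow> 0 \<le> f \<omega>"
    and nz: "\<not> (AE \<omega> in M. f \<omega> = 0)" and int: "integrable M (\<lambda>\<omega>. f \<omega> powr \<alpha>)"
  shows "f \<in> L_plus M \<alpha>"
proof -
  have "(\<integral>\<^sup>+ \<omega>. ennreal (\<bar>f \<omega>\<bar> powr \<alpha>) \<partial>M) = (\<integral>\<^sup>+ \<omega>. ennreal (norm (f \<omega> powr \<alpha>)) \<partial>M)"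
    by (intro nn_integral_cong) (simp add: nn)
  also have "\<dots> < \<infinity>" using int by (simp add: integrable_iff_bounded)
  finally show ?thesis using nn nz by (simp add: L_plus_def L_def nonneg_nonzero_def)
qed

lemma L_plus_subset_L0_plus: "L_plus M \<alpha> \<subseteq> L0_plus M"
  by (auto simp: L_plus_def L_def L0_plus_def)

text \<open>
  This crude bound via the maximum suffices for closure under mixtures and avoids
  Minkowski's inequality.
\<close>

lemma convex_combination_powr_le:
  fixes a b t \<alpha> :: real
  assumes "a \<ge> 0" "b \<ge> 0" "t \<in> {0..1}" "\<alpha> \<ge> 0"
  shows "((1 - t) * a + t * b) powr \<alpha> \<le> a powr \<alpha> + b powr \<alpha>"
proof -
  have "(1 - t) * a + t * b \<le> (1 - t) * max a b + t * max a b"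
    using assms by (intro add_mono mult_left_mono) auto
  then have "(1 - t) * a + t * b \<le> max a b" by (simp add: algebra_simps)
  then have "((1 - t) * a + t * b) powr \<alpha> \<le> max a b powr \<alpha>"
    using assms by (intro powr_mono2) auto
  also have "\<dots> \<le> a powr \<alpha> + b powr \<alpha>" by (simp add: max_def)
  finally show ?thesis .
qed

lemma convex_L_plus:
  assumes "\<alpha> \<ge> 0"
  shows "convex_funs (L_plus M \<alpha>)"
  unfolding convex_funs_def
proof (intro ballI)
  fix f g and t :: real
  assume f: "f \<in> L_plus M \<alpha>" and g: "g \<in> L_plus M \<alpha>" and t: "t \<in> {0..1}"
  note [measurable] = L_plus_measurable[OF f] L_plus_measurable[OF g]
  let ?h = "\<lambda>\<omega>. (1 - t) * f \<omega> + t * g \<omega>"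
  show "?h \<in> L_plus M \<alpha>"
  proof (rule L_plusI)
    show "0 \<le> ?h \<omega>" if "\<omega> \<in> space M" for \<omega>
      using that L_plus_nonneg[OF f] L_plus_nonneg[OF g] t by simp
    show "\<not> (AE \<omega> in M. ?h \<omega> = 0)"
    proof
      assume 0: "AE \<omega> in M. ?h \<omega> = 0"
      show False
      proof (cases "t = 1")
        case True
        then show False using 0 L_plus_nonzero[OF g] by simp
      next
        case False
        have "AE \<omega> in M. f \<omega> = 0"
          using 0 AE_space
        proof eventually_elim
          case (elim \<omega>)
          have "(1 - t) * f \<omega> \<ge> 0" "t * g \<omega> \<ge> 0"
            using elim L_plus_nonneg[OF f] L_plus_nonneg[OF g] t by auto
          then have "(1 - t) * f \<omega> = 0" using elim by linarith
          then show ?case using False by simp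
        qed
        then show False using L_plus_nonzero[OF f] by simp
      qed
    qed
    show "integrable M (\<lambda>\<omega>. ?h \<omega> powr \<alpha>)"
    proof (rule Bochner_Integration.integrable_bound)
      show "integrable M (\<lambda>\<omega>. f \<omega> powr \<alpha> + g \<omega> powr \<alpha>)"
        using L_plus_integrable_powr[OF f] L_plus_integrable_powr[OF g] by simp
      show "AE \<omega> in M. norm (?h \<omega> powr \<alpha>) \<le> norm (f \<omega> powr \<alpha> + g \<omega> powr \<alpha>)"
        using AE_space
        by eventually_elim
          (use convex_combination_powr_le[OF L_plus_nonneg[OF f] L_plus_nonneg[OF g] t assms]
            in \<open>simp add: abs_of_nonneg\<close>)
    qed measurable
  qed measurable
qed

section \<open>Positive exponents\<close>

lemma integral_powr_pos:
  assumes g: "g \<in> L_plus M \<alpha>"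
  shows "(\<integral>\<omega>. g \<omega> powr \<alpha> \<partial>M) > 0"
proof -
  have "(\<integral>\<omega>. g \<omega> powr \<alpha> \<partial>M) \<noteq> 0"
    using L_plus_nonzero[OF g]
    by (subst integral_nonneg_eq_0_iff_AE[OF L_plus_integrable_powr[OF g]]) auto
  moreover have "(\<integral>\<omega>. g \<omega> powr \<alpha> \<partial>M) \<ge> 0" by (intro integral_nonneg_AE) auto
  ultimately show ?thesis by linarith
qed

text \<open>Young's inequality supplies the integrable majorant.\<close>

lemma integrable_mult_powr:
  assumes c: "c > 0" and f: "f \<in> L_plus M (1 + c)" and g: "g \<in> L_plus M (1 + c)"
  shows "integrable M (\<lambda>\<omega>. f \<omega> * g \<omega> powr c)"
proof (rule Bochner_Integration.integrable_bound)
  note [measurable] = L_plus_measurable[OF f] L_plus_measurable[OF g]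
  show "(\<lambda>\<omega>. f \<omega> * g \<omega> powr c) \<in> borel_measurable M" by measurable
  show "integrable M (\<lambda>\<omega>. f \<omega> powr (1 + c) + c * g \<omega> powr (1 + c))"
    using L_plus_integrable_powr[OF f] L_plus_integrable_powr[OF g] by simp
  show "AE \<omega> in M. norm (f \<omega> * g \<omega> powr c) \<le> norm (f \<omega> powr (1 + c) + c * g \<omega> powr (1 + c))"
    using AE_space
  proof eventually_elim
    case (elim \<omega>)
    have f0: "f \<omega> \<ge> 0" and g0: "g \<omega> \<ge> 0"
      using elim L_plus_nonneg[OF f] L_plus_nonneg[OF g] by auto
    have "f \<omega> * g \<omega> powr c \<le> (1 + c) * (f \<omega> * g \<omega> powr c)"
      using c f0 by (intro mult_le_cancel_right1[THEN iffD2]) (auto intro: mult_nonneg_nonneg simp: not_less)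
    also have "\<dots> \<le> f \<omega> powr (1 + c) + c * g \<omega> powr (1 + c)"
      by (rule young_powr(1)[OF c f0 g0])
    finally show ?case using f0 c by simp
  qed
qed

text \<open>
  Hoelder's inequality with its equality case, written in terms of the ratio \<open>z\<close> that
  enters \<open>\<phi>\<close>. Among all scales \<open>s \<ge> 0\<close>, the choice \<open>s = z\<close> makes the
  integrated Young inequality for \<open>f\<close> and \<open>s g\<close> sharpest.
\<close>

lemma holder_ratio:
  assumes c: "c > 0" and f: "f \<in> L_plus M (1 + c)" and g: "g \<in> L_plus M (1 + c)"
  defines "z \<equiv> (\<integral>\<omega>. f \<omega> * g \<omega> powr c \<partial>M) / (\<integral>\<omega>. g \<omega> powr (1 + c) \<partial>M)"
  shows "z \<ge> 0"
    and "z powr (1 + c) * (\<integral>\<omega>. g \<omega> powr (1 + c) \<partial>M) \<le> (\<integral>\<omega>. f \<omega> powr (1 + c) \<partial>M)"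
    and "z powr (1 + c) * (\<integral>\<omega>. g \<omega> powr (1 + c) \<partial>M) = (\<integral>\<omega>. f \<omega> powr (1 + c) \<partial>M)
      \<Longrightarrow> AE \<omega> in M. f \<omega> = z * g \<omega>"
proof -
  let ?G = "\<integral>\<omega>. g \<omega> powr (1 + c) \<partial>M" and ?F = "\<integral>\<omega>. f \<omega> powr (1 + c) \<partial>M"
  let ?l = "\<lambda>\<omega>. (1 + c) * (f \<omega> * (z * g \<omega>) powr c)"
  let ?r = "\<lambda>\<omega>. f \<omega> powr (1 + c) + c * (z * g \<omega>) powr (1 + c)"
  have G: "?G > 0" by (rule integral_powr_pos[OF g])
  have "(\<integral>\<omega>. f \<omega> * g \<omega> powr c \<partial>M) \<ge> 0"
    using L_plus_nonneg[OF f] by (intro Bochner_Integration.integral_nonneg) auto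
  then show z: "z \<ge> 0" unfolding z_def using G by simp
  have g0: "AE \<omega> in M. g \<omega> \<ge> 0" and f0: "AE \<omega> in M. f \<omega> \<ge> 0"
    using L_plus_nonneg[OF g] L_plus_nonneg[OF f] by auto
  have l_eq: "?l \<omega> = (1 + c) * z powr c * (f \<omega> * g \<omega> powr c)"
    and r_eq: "?r \<omega> = f \<omega> powr (1 + c) + c * z powr (1 + c) * g \<omega> powr (1 + c)"
    if "\<omega> \<in> space M" for \<omega>
    using z L_plus_nonneg[OF g that] by (simp_all add: powr_mult algebra_simps)
  have il: "integrable M ?l"
    using integrable_mult_powr[OF c f g] by (subst Bochner_Integration.integrable_cong[OF refl l_eq]) auto
  have ir: "integrable M ?r"
    using L_plus_integrable_powr[OF f] L_plus_integrable_powr[OF g]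
    by (subst Bochner_Integration.integrable_cong[OF refl r_eq]) auto
  have zG: "(\<integral>\<omega>. f \<omega> * g \<omega> powr c \<partial>M) = z * ?G" using G by (simp add: z_def)
  have "(\<integral>\<omega>. ?l \<omega> \<partial>M) = (1 + c) * z powr c * (z * ?G)"
    unfolding zG[symmetric] using l_eq
    by (subst Bochner_Integration.integral_cong[OF refl l_eq]) auto
  also have "\<dots> = (1 + c) * (z powr (1 + c) * ?G)"
    using z by (simp add: powr_add)
  finally have vl: "(\<integral>\<omega>. ?l \<omega> \<partial>M) = (1 + c) * (z powr (1 + c) * ?G)" .
  have vr: "(\<integral>\<omega>. ?r \<omega> \<partial>M) = ?F + c * (z powr (1 + c) * ?G)"
    using L_plus_integrable_powr[OF f] L_plus_integrable_powr[OF g]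
    by (subst Bochner_Integration.integral_cong[OF refl r_eq]) auto
  have le: "AE \<omega> in M. ?l \<omega> \<le> ?r \<omega>"
    using f0 g0 by eventually_elim (use c z in \<open>intro young_powr(1)\<close>, auto)
  have "(\<integral>\<omega>. ?l \<omega> \<partial>M) \<le> (\<integral>\<omega>. ?r \<omega> \<partial>M)"
    by (rule integral_mono_AE[OF il ir le])
  then show "z powr (1 + c) * ?G \<le> ?F" unfolding vl vr by (simp add: algebra_simps)
  assume eq: "z powr (1 + c) * ?G = ?F"
  then have "(\<integral>\<omega>. ?l \<omega> \<partial>M) = (\<integral>\<omega>. ?r \<omega> \<partial>M)" unfolding vl vr by (simp add: algebra_simps)
  from AE_eq_of_AE_le_integral_eq[OF il ir le this] f0 g0
  show "AE \<omega> in M. f \<omega> = z * g \<omega>"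
    by eventually_elim (use z in \<open>auto intro: young_powr(2)[OF c]\<close>)
qed

lemma holder_score_self:
  assumes "f \<in> L_plus M (1 + c)" "\<phi> 1 = -1"
  shows "holder_score M c \<phi> f f = - (\<integral>\<omega>. f \<omega> powr (1 + c) \<partial>M)"
proof -
  have "(\<integral>\<omega>. f \<omega> * f \<omega> powr c \<partial>M) = (\<integral>\<omega>. f \<omega> powr (1 + c) \<partial>M)"
    using L_plus_nonneg[OF assms(1)]
    by (intro Bochner_Integration.integral_cong) (auto simp: powr_add)
  then show ?thesis
    using integral_powr_pos[OF assms(1)] assms(2) by (simp add: holder_score_def)
qed

text \<open>
  The lower bound on \<open>\<phi>\<close> and \<open>holder_ratio\<close> combine to the chain
  \<open>S(f, g) \<ge> - z\<^sup>1\<^sup>+\<^sup>\<gamma> \<langle>g\<^sup>1\<^sup>+\<^sup>\<gamma>\<rangle> \<ge> - \<langle>f\<^sup>1\<^sup>+\<^sup>\<gamma>\<rangle> = S(f, f)\<close>. Equality of the two ends forces equality in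
  Hoelder's inequality.
\<close>

theorem composite_score_holder_pos:
  assumes c: "c > 0" and \<phi>1: "\<phi> 1 = -1" and \<phi>: "\<And>z. z \<ge> 0 \<Longrightarrow> \<phi> z \<ge> - (z powr (1 + c))"
  shows "composite_score M (L_plus M (1 + c)) (holder_score M c \<phi>)"
proof -
  let ?F = "L_plus M (1 + c)"
  define I where "I f = (\<integral>\<omega>. f \<omega> powr (1 + c) \<partial>M)" for f
  define z where "z f g = (\<integral>\<omega>. f \<omega> * g \<omega> powr c \<partial>M) / I g" for f g
  have lower: "- (z f g powr (1 + c) * I g) \<le> holder_score M c \<phi> f g"
    and hold: "z f g powr (1 + c) * I g \<le> I f" if "f \<in> ?F" "g \<in> ?F" for f g
  proof -
    have "- (z f g powr (1 + c)) * I g \<le> \<phi> (z f g) * I g"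
      using \<phi>[of "z f g"] holder_ratio(1)[OF c that] integral_powr_pos[OF that(2)]
      by (intro mult_right_mono) (auto simp: z_def I_def)
    then show "- (z f g powr (1 + c) * I g) \<le> holder_score M c \<phi> f g"
      by (simp add: holder_score_def z_def I_def)
    show "z f g powr (1 + c) * I g \<le> I f"
      using holder_ratio(2)[OF c that] by (simp add: z_def I_def)
  qed
  have self: "holder_score M c \<phi> f f = - I f" if "f \<in> ?F" for f
    using holder_score_self[of f M c \<phi>, OF that \<phi>1] by (simp add: I_def)
  have comp: "\<exists>S0 T. \<forall>f\<in>?F. \<forall>g\<in>?F. integrable M (\<lambda>\<omega>. S0 \<omega> g * f \<omega>) \<and>
        holder_score M c \<phi> f g = T (\<integral>\<omega>. S0 \<omega> g * f \<omega> \<partial>M) g"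
    by (intro exI[of _ "\<lambda>\<omega> g. g \<omega> powr c"] exI[of _ "\<lambda>x g. \<phi> (x / I g) * I g"])
      (auto simp: holder_score_def I_def mult.commute[of "_ powr c"] intro: integrable_mult_powr[OF c])
  have min: "holder_score M c \<phi> f f \<le> holder_score M c \<phi> f g" if "f \<in> ?F" "g \<in> ?F" for f g
    using lower[OF that] hold[OF that] self[OF that(1)] by linarith
  have strict: "AE \<omega> in M. p \<omega> = q \<omega>"
    if p: "p \<in> densities M ?F" and q: "q \<in> densities M ?F"
      and eq: "holder_score M c \<phi> p q = holder_score M c \<phi> p p" for p q
  proof -
    have pF: "p \<in> ?F" and qF: "q \<in> ?F" and p1: "(\<integral>\<omega>. p \<omega> \<partial>M) = 1" and q1: "(\<integral>\<omega>. q \<omega> \<partial>M) = 1"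
      using p q by (auto simp: densities_def)
    have "z p q powr (1 + c) * I q = I p"
      using lower[OF pF qF] hold[OF pF qF] self[OF pF] eq by linarith
    then have ae: "AE \<omega> in M. p \<omega> = z p q * q \<omega>"
      using holder_ratio(3)[OF c pF qF] by (simp add: z_def I_def)
    note [measurable] = L_plus_measurable[OF pF] L_plus_measurable[OF qF]
    have "(\<integral>\<omega>. p \<omega> \<partial>M) = (\<integral>\<omega>. z p q * q \<omega> \<partial>M)"
      by (intro integral_cong_AE ae) measurable
    then have "z p q = 1" using p1 q1 by simp
    then show ?thesis using ae by simp
  qed
  show ?thesis
    unfolding composite_score_def
    using L_plus_subset_L0_plus convex_L_plus[of "1 + c" M] c comp min strict by auto
qed

section \<open>The logarithmic case\<close>

lemma integrable_of_L_plus_1: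
  assumes "f \<in> L_plus M 1"
  shows "integrable M f"
proof -
  have "integrable M (\<lambda>\<omega>. f \<omega> powr 1)" by (rule L_plus_integrable_powr[OF assms])
  then show ?thesis
    using L_plus_nonneg[OF assms] by (simp cong: Bochner_Integration.integrable_cong)
qed

text \<open>
  Where \<open>g = 0 \<noteq> f\<close> the integrand is infinite, a value that an integrable function takes only on a
  null set.
\<close>

lemma AE_zero_of_ext_integrable_times_log:
  assumes "ext_integrable M (times_log f g)"
  shows "AE \<omega> in M. g \<omega> = 0 \<longrightarrow> f \<omega> = 0"
proof -
  have [measurable]: "times_log f g \<in> borel_measurable M"
    and fin: "(\<integral>\<^sup>+ \<omega>. e2ennreal \<bar>times_log f g \<omega>\<bar> \<partial>M) < \<infinity>"
    using assms by (auto simp: ext_integrable_def)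
  have "AE \<omega> in M. e2ennreal \<bar>times_log f g \<omega>\<bar> \<noteq> \<infinity>"
    using fin by (intro nn_integral_PInf_AE) auto
  then show ?thesis
  proof eventually_elim
    case (elim \<omega>)
    have "e2ennreal \<bar>times_log f g \<omega>\<bar> = \<infinity>" if "g \<omega> = 0" "f \<omega> \<noteq> 0"
      using that by (simp add: times_log_def ext_log_def)
    then show ?case using elim by fastforce
  qed
qed

lemma times_log_eq_ereal:
  assumes "g \<omega> = 0 \<longrightarrow> f \<omega> = 0"
  shows "times_log f g \<omega> = ereal (f \<omega> * ln (g \<omega>))"
  using assms by (auto simp: times_log_def ext_log_def)

lemma integrable_mult_ln:
  assumes [measurable]: "f \<in> borel_measurable M" "g \<in> borel_measurable M"
    and int: "ext_integrable M (times_log f g)"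
  shows "integrable M (\<lambda>\<omega>. f \<omega> * ln (g \<omega>))"
proof (rule integrableI_bounded)
  have "(\<integral>\<^sup>+ \<omega>. ennreal (norm (f \<omega> * ln (g \<omega>))) \<partial>M) = (\<integral>\<^sup>+ \<omega>. e2ennreal \<bar>times_log f g \<omega>\<bar> \<partial>M)"
    using AE_zero_of_ext_integrable_times_log[OF int]
    by (intro nn_integral_cong_AE, eventually_elim) (simp add: times_log_eq_ereal e2ennreal_ereal)
  also have "\<dots> < \<infinity>" using int by (simp add: ext_integrable_def)
  finally show "(\<integral>\<^sup>+ \<omega>. ennreal (norm (f \<omega> * ln (g \<omega>))) \<partial>M) < \<infinity>" .
qed measurable

lemma ext_integral_eq_integral:
  assumes "integrable M k" and ae: "AE \<omega> in M. h \<omega> = ereal (k \<omega>)"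
  shows "ext_integral M h = (\<integral>\<omega>. k \<omega> \<partial>M)"
proof -
  have "(\<integral>\<^sup>+ \<omega>. e2ennreal (h \<omega>) \<partial>M) = (\<integral>\<^sup>+ \<omega>. ennreal (k \<omega>) \<partial>M)"
    "(\<integral>\<^sup>+ \<omega>. e2ennreal (- h \<omega>) \<partial>M) = (\<integral>\<^sup>+ \<omega>. ennreal (- k \<omega>) \<partial>M)"
    using ae by (auto intro!: nn_integral_cong_AE elim!: eventually_mono simp: e2ennreal_ereal)
  then show ?thesis
    using real_lebesgue_integral_def[OF assms(1)] by (simp add: ext_integral_def)
qed

lemma holder_score_zero_eq:
  assumes f: "f \<in> L_plus M 1" and g: "g \<in> L_plus M 1"
    and int: "ext_integrable M (times_log f g)"
  shows "integrable M (\<lambda>\<omega>. g \<omega> - f \<omega> * ln (g \<omega>))"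
    and "holder_score_zero M f g = (\<integral>\<omega>. g \<omega> - f \<omega> * ln (g \<omega>) \<partial>M)"
proof -
  show i: "integrable M (\<lambda>\<omega>. g \<omega> - f \<omega> * ln (g \<omega>))"
    using integrable_of_L_plus_1[OF g]
      integrable_mult_ln[OF L_plus_measurable[OF f] L_plus_measurable[OF g] int] by simp
  show "holder_score_zero M f g = (\<integral>\<omega>. g \<omega> - f \<omega> * ln (g \<omega>) \<partial>M)"
    unfolding holder_score_zero_def
  proof (rule ext_integral_eq_integral[OF i])
    show "AE \<omega> in M. - times_log f g \<omega> + ereal (g \<omega>) = ereal (g \<omega> - f \<omega> * ln (g \<omega>))"
      using AE_zero_of_ext_integrable_times_log[OF int]
      by eventually_elim (simp add: times_log_eq_ereal)
  qed
qed

text \<open>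
  In the representation, \<open>S\<^sub>0(\<omega>, g) = ln (g \<omega>)\<close> must be real; its value \<open>0\<close> on the zero set of \<open>g\<close>
  is harmless because every \<open>f\<close> in the class vanishes there almost everywhere. Optimality and
  its equality case are \<open>gibbs_pointwise\<close> integrated.
\<close>

theorem composite_score_log:
  assumes sub: "F \<subseteq> L_plus M 1" and conv: "convex_funs F"
    and int: "\<And>f g. f \<in> F \<Longrightarrow> g \<in> F \<Longrightarrow> ext_integrable M (times_log f g)"
  shows "composite_score M F (holder_score_zero M)"
proof -
  have L: "f \<in> L_plus M 1" if "f \<in> F" for f using sub that by blast
  note score = holder_score_zero_eq[OF L L int]
  have le: "AE \<omega> in M. f \<omega> - f \<omega> * ln (f \<omega>) \<le> g \<omega> - f \<omega> * ln (g \<omega>)"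
    and ae_eq: "AE \<omega> in M. f \<omega> - f \<omega> * ln (f \<omega>) = g \<omega> - f \<omega> * ln (g \<omega>) \<longrightarrow> f \<omega> = g \<omega>"
    if "f \<in> F" "g \<in> F" for f g
  proof -
    have "AE \<omega> in M. f \<omega> \<ge> 0 \<and> g \<omega> \<ge> 0 \<and> (g \<omega> = 0 \<longrightarrow> f \<omega> = 0)"
      using AE_space AE_zero_of_ext_integrable_times_log[OF int[OF that]]
      by eventually_elim (use L_plus_nonneg[OF L] that in auto)
    then show "AE \<omega> in M. f \<omega> - f \<omega> * ln (f \<omega>) \<le> g \<omega> - f \<omega> * ln (g \<omega>)"
      and "AE \<omega> in M. f \<omega> - f \<omega> * ln (f \<omega>) = g \<omega> - f \<omega> * ln (g \<omega>) \<longrightarrow> f \<omega> = g \<omega>"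
      by (eventually_elim, metis gibbs_pointwise)+
  qed
  have comp: "\<exists>S0 T. \<forall>f\<in>F. \<forall>g\<in>F. integrable M (\<lambda>\<omega>. S0 \<omega> g * f \<omega>) \<and>
        holder_score_zero M f g = T (\<integral>\<omega>. S0 \<omega> g * f \<omega> \<partial>M) g"
  proof (intro exI ballI conjI)
    fix f g assume fg: "f \<in> F" "g \<in> F"
    have i: "integrable M (\<lambda>\<omega>. f \<omega> * ln (g \<omega>))"
      using integrable_mult_ln L_plus_measurable[OF L] int fg by blast
    then show "integrable M (\<lambda>\<omega>. ln (g \<omega>) * f \<omega>)" by (simp add: mult.commute)
    show "holder_score_zero M f g = (\<lambda>x g. (\<integral>\<omega>. g \<omega> \<partial>M) - x) (\<integral>\<omega>. ln (g \<omega>) * f \<omega> \<partial>M) g"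
      using i integrable_of_L_plus_1[OF L[OF fg(2)]] fg by (simp add: score(2) mult.commute)
  qed
  have min: "holder_score_zero M f f \<le> holder_score_zero M f g" if "f \<in> F" "g \<in> F" for f g
    using that by (simp add: score(2) integral_mono_AE[OF score(1) score(1) le])
  have strict: "AE \<omega> in M. p \<omega> = q \<omega>"
    if "p \<in> F" "q \<in> F" "holder_score_zero M p q = holder_score_zero M p p" for p q
  proof -
    have "AE \<omega> in M. p \<omega> - p \<omega> * ln (p \<omega>) = q \<omega> - p \<omega> * ln (q \<omega>)"
      using that by (intro AE_eq_of_AE_le_integral_eq score(1) le) (auto simp: score(2))
    with ae_eq[OF that(1,2)] show ?thesis by eventually_elim simp
  qed
  show ?thesis
    unfolding composite_score_def
    using sub L_plus_subset_L0_plus[of M 1] conv comp min strict by (auto simp: densities_def)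
qed

section \<open>The Hoelder score\<close>

theorem theorem1:
  fixes M :: "'a measure"
  assumes "sigma_finite_measure M"
  shows "(\<forall>(\<gamma>::real) (\<phi>::real \<Rightarrow> real).
            \<gamma> > 0 \<and> \<phi> 1 = - 1 \<and> (\<forall>z\<ge>0. \<phi> z \<ge> - (z powr (1 + \<gamma>))) \<longrightarrow>
            composite_score M (L_plus M (1 + \<gamma>)) (holder_score M \<gamma> \<phi>)) \<and>
         (\<forall>F :: ('a \<Rightarrow> real) set.
            F \<subseteq> L_plus M 1 \<and> convex_funs F \<and>
            (\<forall>f\<in>F. \<forall>g\<in>F. ext_integrable M (times_log f g)) \<longrightarrow>
            composite_score M F (holder_score_zero M))"
  using composite_score_holder_pos composite_score_log by blast

end
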